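(* There exists $d_0$ such that for every integer $d\ge d_0$, every $d$-maximal set $S\subset[2]^\infty$ that contains no $1$-ball satisfies \[ |S|\le (4-10^{-10})^d. \]
   Context: $[2]=\{1,2\}$ and $[2]^\infty$ is the set of infinite sequences over $[2]$. Hamming distance $\mathrm{dist}(a,b)=|\{i:a_i\ne b_i\}|$; $\mathrm{diam}(S)=\sup_{a,b\in S}\mathrm{dist}(a,b)$. $S$ is $d$-maximal if $\mathrm{diam}(S)=d$ and $S$ is inclusion-maximal among subsets of $[2]^\infty$ of diameter $d$. A $1$-ball is a set $\mathrm{Ball}(a,1)=\{b:\mathrm{dist}(a,b)\le1\}$ for some $a\in[2]^\infty$; $S$ contains a $1$-ball if $\mathrm{Ball}(a,1)\subset S$ for some $a$. *)

theory Defs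
  imports Complex_Main "HOL-Library.Extended_Nat" "HOL-Library.FuncSet"
begin

definition binary_seqs :: "(nat \<Rightarrow> nat) set" where
  "binary_seqs = UNIV \<rightarrow> {1, 2}"

definition hamming_dist :: "(nat \<Rightarrow> nat) \<Rightarrow> (nat \<Rightarrow> nat) \<Rightarrow> enat" where
  "hamming_dist a b =
     (if finite {i. a i \<noteq> b i} then enat (card {i. a i \<noteq> b i}) else \<infinity>)"

definition hamming_diam :: "(nat \<Rightarrow> nat) set \<Rightarrow> enat" where
  "hamming_diam S = (SUP a\<in>S. SUP b\<in>S. hamming_dist a b)"

definition diam_maximal :: "nat \<Rightarrow> (nat \<Rightarrow> nat) set \<Rightarrow> bool" where
  "diam_maximal d S \<longleftrightarrow>
     S \<subseteq> binary_seqs \<and> hamming_diam S = enat d \<and>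
     (\<forall>T. S \<subseteq> T \<and> T \<subseteq> binary_seqs \<and> hamming_diam T = enat d \<longrightarrow> T = S)"

definition hamming_ball :: "(nat \<Rightarrow> nat) \<Rightarrow> nat \<Rightarrow> (nat \<Rightarrow> nat) set" where
  "hamming_ball a r = {b \<in> binary_seqs. hamming_dist a b \<le> enat r}"

definition contains_one_ball :: "(nat \<Rightarrow> nat) set \<Rightarrow> bool" where
  "contains_one_ball S \<longleftrightarrow> (\<exists>a\<in>binary_seqs. hamming_ball a 1 \<subseteq> S)"

end

theory Submission imports Defs begin

text \<open>
  Measured from a fixed element, the sequences of \<open>S\<close> become finite sets at distance at most \<open>d\<close>
  from each other. By maximality and the absence of a 1-ball, every finite set \<open>X\<close> has a member of
  the family at distance at least \<open>d\<close>. Consider the random walk that, at \<open>X\<close>, flips a random element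
  of the difference between \<open>X\<close> and such a far member. It approaches each member \<open>A\<close> at least as fast
  as the simple random walk on a cube of dimension \<open>2d\<close> approaches a vertex. In generating-function
  form this says that the sum of \<open>r ^ dist(X, A)\<close> over all members is at most \<open>(1 + r) ^ (2d)\<close>, for
  every \<open>X\<close>; so if the mean distance from some \<open>X\<close> is at most \<open>(1 - \<delta>) d\<close>, there are at most
  \<open>(4 - \<epsilon>) ^ d\<close> members.

  Take for \<open>X\<close> the coordinatewise majority. If its mean distance to the family exceeds
  \<open>(1 - \<delta>) d\<close>, then, as the mean distance between two members is at most \<open>d\<close>, almost every coordinate
  that matters is nearly balanced and there are about \<open>2d\<close> of them. The traces on these coordinates
  have diameter at most \<open>d\<close>, so there are at most about \<open>3.08 ^ d\<close> of them (a weak form of Kleitman's theorem),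
  and the generating-function bound controls the number of members with a given trace.
\<close>

section \<open>Hamming distance of finite sets\<close>

definition sdist :: "'a set \<Rightarrow> 'a set \<Rightarrow> nat" where
  "sdist A B = card (sym_diff A B)"

lemma sdist_mono:
  assumes "finite C" "finite D" "sym_diff A B \<subseteq> sym_diff C D"
  shows "sdist A B \<le> sdist C D"
  unfolding sdist_def by (rule card_mono) (use assms in auto)

lemma sdist_eq_0_iff: "finite A \<Longrightarrow> finite B \<Longrightarrow> sdist A B = 0 \<longleftrightarrow> A = B"
  by (auto simp: sdist_def)

lemma sdist_flip:
  assumes "finite X" "finite A"
  shows "sdist (sym_diff X {i}) A =
    (if i \<in> sym_diff X A then sdist X A - 1 else sdist X A + 1)"
proof (cases "i \<in> sym_diff X A")
  case True
  then have "sym_diff (sym_diff X {i}) A = sym_diff X A - {i}" by auto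
  with True assms show ?thesis by (simp add: sdist_def del: Un_iff Diff_iff)
next
  case False
  then have "sym_diff (sym_diff X {i}) A = insert i (sym_diff X A)" by auto
  with False assms show ?thesis by (simp add: sdist_def del: Un_iff Diff_iff)
qed

section \<open>The generating-function bound\<close>

text \<open>The left side is half the corresponding sum over all \<open>2 * d\<close> flips in a
  cube of dimension \<open>2 * d\<close>, at distance \<open>sdist X A\<close> from a vertex. A flip
  in \<open>D\<close> shortens the distance to \<open>A\<close> exactly when it lies in
  \<open>E\<close>. As \<open>sym_diff A T\<close> is the symmetric difference of \<open>D\<close>
  and \<open>E\<close>, \<open>near\<close> gives \<open>card D + k - 2 * j \<le> d\<close>, so
  enough flips shorten it.\<close>

lemma flip_weight_sum_ge:
  fixes r :: real
  assumes fin: "finite X" "finite A" "finite T"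
    and near: "sdist A T \<le> d" and far: "d \<le> sdist X T" and r: "0 \<le> r" "r \<le> 1"
  shows "(1 - r) * ((1 + r) * (real (sdist X A) * r ^ (sdist X A - 1)) / 2 - real d * r ^ sdist X A)
    \<le> (\<Sum>i\<in>sym_diff X T. r ^ sdist (sym_diff X {i}) A - r ^ sdist X A)"
proof -
  define D where "D = sym_diff X T"
  define E where "E = sym_diff X A"
  define k where "k = card E"
  define j where "j = card (D \<inter> E)"
  have finD: "finite D" "finite E" using fin by (auto simp: D_def E_def)
  have kX: "sdist X A = k" by (simp add: k_def E_def sdist_def)
  have D: "d \<le> card D" using far by (simp add: D_def sdist_def)
  have jD: "j + card (D - E) = card D"
    using card_Int_Diff[OF finD(1), of E] by (simp add: j_def)
  have jE: "j + card (E - D) = k"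
    using card_Int_Diff[OF finD(2), of D] by (simp add: j_def k_def Int_commute)
  have "sym_diff A T = (D - E) \<union> (E - D)" by (auto simp: D_def E_def)
  then have "card (D - E) + card (E - D) \<le> d"
    using near card_Un_disjoint[of "D - E" "E - D"] finD by (simp add: sdist_def disjoint_iff)
  with jD jE have key: "card D + k \<le> d + 2 * j" by linarith
  have "(\<Sum>i\<in>D. r ^ sdist (sym_diff X {i}) A - r ^ k)
      = (\<Sum>i\<in>D \<inter> E. r ^ (k - 1) - r ^ k) + (\<Sum>i\<in>D - E. r ^ (k + 1) - r ^ k)"
    unfolding sum.Int_Diff[OF finD(1), of _ E]
    by (intro arg_cong2[of _ _ _ _ "(+)"] sum.cong refl)
       (simp_all add: sdist_flip[OF fin(1,2)] kX E_def[symmetric] del: Un_iff)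
  also have "\<dots> = real j * (r ^ (k - 1) - r ^ k) + (real (card D) - real j) * (r ^ (k + 1) - r ^ k)"
    using jD by (simp add: j_def[symmetric] flip: jD)
  finally have sum: "(\<Sum>i\<in>D. r ^ sdist (sym_diff X {i}) A - r ^ k) = \<dots>" .
  show ?thesis
  proof (cases k)
    case 0
    with jE key D have "card D = d" "j = 0" by auto
    with sum 0 show ?thesis by (simp add: kX D_def algebra_simps)
  next
    case (Suc k')
    \<comment> \<open>Flips beyond the first \<open>d\<close> do no harm: a surplus of
      \<open>e\<close> flips forces \<open>2 * j - k \<ge> e\<close>, and
      \<open>(1 + r) * e \<ge> 2 * r * e\<close> because \<open>r \<le> 1\<close>.\<close>
    define e where "e = real (card D) - real d"
    define q where "q = r ^ k'"
    have "q \<ge> 0" using r by (simp add: q_def)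
    have e: "e \<ge> 0" "2 * real j - real k \<ge> e" using D key by (auto simp: e_def)
    have "(1 + r) * e \<le> (1 + r) * (2 * real j - real k)"
      using e r by (intro mult_left_mono) auto
    moreover have "r * e \<le> 1 * e" using e r by (intro mult_right_mono) auto
    ultimately have "0 \<le> (1 + r) * (2 * real j - real k) - 2 * r * e" by (simp add: algebra_simps)
    then have "0 \<le> q * (1 - r) / 2 * ((1 + r) * (2 * real j - real k) - 2 * r * e)"
      using r \<open>q \<ge> 0\<close> by (intro mult_nonneg_nonneg) auto
    also have "\<dots> = real j * (r ^ (k - 1) - r ^ k) + (real (card D) - real j) * (r ^ (k + 1) - r ^ k)
       - (1 - r) * ((1 + r) * (real k * r ^ (k - 1)) / 2 - real d * r ^ k)"
      by (simp add: Suc q_def[symmetric] e_def field_simps)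
    finally show ?thesis using sum by (simp add: kX D_def)
  qed
qed

text \<open>If \<open>Y\<close> maximises \<open>f Y s\<close>, no flip increases \<open>f\<close>.
  Summing the previous inequality over the family, with \<open>T\<close> far from \<open>Y\<close>,
  then bounds the logarithmic \<open>s\<close>-derivative of \<open>f\<close> by
  \<open>2 * d / (1 + s)\<close>, that of \<open>(1 + s) ^ (2 * d)\<close>. At \<open>s = 0\<close>
  the sum is at most 1. Intersecting with \<open>U\<close> never increases a distance to a member,
  so finitely many \<open>Y\<close> suffice.\<close>

lemma weight_sum_le:
  fixes r :: real
  assumes fin: "finite \<A>" "\<And>A. A \<in> \<A> \<Longrightarrow> finite A" "\<And>T. T \<in> \<T> \<Longrightarrow> finite T"
    and near: "\<And>A T. A \<in> \<A> \<Longrightarrow> T \<in> \<T> \<Longrightarrow> sdist A T \<le> d"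
    and far: "\<And>X. finite X \<Longrightarrow> \<exists>T\<in>\<T>. d \<le> sdist X T"
    and r: "0 \<le> r" "r < 1" and X: "finite X"
  shows "(\<Sum>A\<in>\<A>. r ^ sdist X A) \<le> (1 + r) ^ (2 * d)"
proof -
  define U where "U = \<Union>\<A>"
  have U: "finite U" using fin by (auto simp: U_def)
  define f where "f = (\<lambda>X (s::real). \<Sum>A\<in>\<A>. s ^ sdist X A)"
  define f' where "f' = (\<lambda>X (s::real). \<Sum>A\<in>\<A>. real (sdist X A) * s ^ (sdist X A - 1))"
  \<comment> \<open>\<open>w s\<close> is \<open>(1 + s)\<close> to the power
    \<open>- 2 * d\<close>; the claim becomes \<open>f * w \<le> 1\<close>.\<close>
  define w where "w = (\<lambda>s::real. exp (- (2 * real d * ln (1 + s))))"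
  have f_deriv: "(f Y has_real_derivative f' Y s) (at s)" for Y s
    unfolding f_def f'_def by (auto intro!: derivative_eq_intros)
  have w_deriv: "(w has_real_derivative - (2 * real d / (1 + s)) * w s) (at s)" if "s \<ge> 0" for s
    unfolding w_def using that by (auto intro!: derivative_eq_intros simp: field_simps)
  have wpos: "w s > 0" for s by (simp add: w_def)
  have f_Int: "f Y s \<le> f (Y \<inter> U) s" if "finite Y" "0 \<le> s" "s \<le> 1" for Y s
    unfolding f_def
  proof (rule sum_mono)
    fix A assume "A \<in> \<A>"
    then have "sdist (Y \<inter> U) A \<le> sdist Y A"
      using that fin by (intro sdist_mono) (auto simp: U_def)
    with that show "s ^ sdist Y A \<le> s ^ sdist (Y \<inter> U) A" by (intro power_decreasing)
  qed
  have at_max: "f' Y s \<le> 2 * real d / (1 + s) * f Y s"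
    if s: "0 \<le> s" "s < 1" and Y: "Y \<subseteq> U" and max: "\<And>Z. Z \<subseteq> U \<Longrightarrow> f Z s \<le> f Y s" for Y s
  proof -
    have finY: "finite Y" using Y U finite_subset by blast
    obtain T where T: "T \<in> \<T>" "d \<le> sdist Y T" using far[OF finY] by blast
    have "(1 - s) * ((1 + s) * f' Y s / 2 - real d * f Y s) =
      (\<Sum>A\<in>\<A>. (1 - s) * ((1 + s) * (real (sdist Y A) * s ^ (sdist Y A - 1)) / 2 - real d * s ^ sdist Y A))"
      by (simp add: f_def f'_def sum_distrib_left sum_subtractf right_diff_distrib sum_divide_distrib)
    also have "\<dots> \<le> (\<Sum>A\<in>\<A>. \<Sum>i\<in>sym_diff Y T. s ^ sdist (sym_diff Y {i}) A - s ^ sdist Y A)"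
      by (intro sum_mono flip_weight_sum_ge) (use finY fin near T s in auto)
    also have "\<dots> = (\<Sum>i\<in>sym_diff Y T. f (sym_diff Y {i}) s - f Y s)"
      by (subst sum.swap) (simp add: f_def sum_subtractf)
    also have "\<dots> \<le> 0"
    \<comment> \<open>\<open>T\<close> may leave \<open>U\<close>, so the flipped set is cut back to
      \<open>U\<close> before maximality is applied.\<close>
    proof (rule sum_nonpos)
      fix i
      have "f (sym_diff Y {i}) s \<le> f (sym_diff Y {i} \<inter> U) s"
        using finY s by (intro f_Int) auto
      also have "\<dots> \<le> f Y s" by (rule max) auto
      finally show "f (sym_diff Y {i}) s - f Y s \<le> 0" by simp
    qed
    finally have "(1 + s) * f' Y s / 2 - real d * f Y s \<le> 0"
      using s by (simp add: mult_le_0_iff)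
    then show ?thesis using s by (simp add: field_simps)
  qed
  \<comment> \<open>Maximum principle in the parameter: perturbed by \<open>- e * s\<close>, the maximum over all \<open>Z\<close> and \<open>s\<close>
     cannot lie at \<open>s > 0\<close>, because there the derivative at a maximiser would be negative.\<close>
  have bound: "f Y r * w r \<le> 1 + e * r" if e: "e > 0" and "Y \<subseteq> U" for Y e
  proof -
    define G where "G = (\<lambda>Z s. f Z s * w s - e * s)"
    have G_deriv: "(G Z has_real_derivative
        (f' Z s - 2 * real d / (1 + s) * f Z s) * w s - e) (at s)" if "s \<ge> 0" for Z s
      unfolding G_def by (rule derivative_eq_intros f_deriv w_deriv that refl)+ (simp add: algebra_simps)
    have cont: "continuous_on {0..r} (G Z)" for Z
      by (rule DERIV_continuous_on[of _ _ "\<lambda>s. (f' Z s - 2 * real d / (1 + s) * f Z s) * w s - e"])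
         (simp only: atLeastAtMost_iff, blast intro: has_field_derivative_at_within G_deriv)
    have "\<exists>s\<in>{0..r}. \<forall>t\<in>{0..r}. G Z t \<le> G Z s" for Z
      by (rule continuous_attains_sup) (use cont r in auto)
    then obtain t where t: "\<And>Z. t Z \<in> {0..r}" "\<And>Z s. s \<in> {0..r} \<Longrightarrow> G Z s \<le> G Z (t Z)"
      by metis
    define V where "V = (\<lambda>Z. G Z (t Z)) ` Pow U"
    have "finite V" "V \<noteq> {}" using U by (auto simp: V_def)
    then have "Max V \<in> V" by (rule Max_in)
    then obtain Z where Z: "Z \<subseteq> U" "G Z (t Z) = Max V" by (auto simp: V_def)
    have le: "G Y' s \<le> G Z (t Z)" if "Y' \<subseteq> U" "s \<in> {0..r}" for Y' s
    proof -
      have "G Y' s \<le> G Y' (t Y')" using t that by auto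
      also have "\<dots> \<le> Max V" using that \<open>finite V\<close> by (intro Max_ge) (auto simp: V_def)
      finally show ?thesis by (simp add: Z)
    qed
    have tz: "0 \<le> t Z" "t Z \<le> r" using t(1)[of Z] by auto
    have "t Z = 0"
    proof (rule ccontr)
      assume "t Z \<noteq> 0"
      have "f Z' (t Z) \<le> f Z (t Z)" if "Z' \<subseteq> U" for Z'
        using le[OF that t(1)[of Z]] wpos[of "t Z"] by (simp add: G_def)
      then have "f' Z (t Z) \<le> 2 * real d / (1 + t Z) * f Z (t Z)"
        using tz r Z by (intro at_max) auto
      then have "(f' Z (t Z) - 2 * real d / (1 + t Z) * f Z (t Z)) * w (t Z) \<le> 0"
        using wpos[of "t Z"] by (simp add: mult_le_0_iff)
      with e have "(f' Z (t Z) - 2 * real d / (1 + t Z) * f Z (t Z)) * w (t Z) - e < 0" by simp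
      from DERIV_neg_dec_left[OF G_deriv[OF tz(1)] this]
      obtain \<delta> where \<delta>: "\<delta> > 0" "\<And>h. 0 < h \<Longrightarrow> h < \<delta> \<Longrightarrow> G Z (t Z) < G Z (t Z - h)" by blast
      define h where "h = min (\<delta> / 2) (t Z)"
      have "0 < h" "h < \<delta>" "h \<le> t Z" using \<delta>(1) tz \<open>t Z \<noteq> 0\<close> by (auto simp: h_def)
      with \<delta>(2)[of h] le[OF Z(1), of "t Z - h"] tz show False by auto
    qed
    have finZ: "finite Z" using Z U finite_subset by blast
    \<comment> \<open>Since \<open>0 ^ 0 = 1\<close>, at parameter 0 only \<open>A = Z\<close>
      contributes.\<close>
    have "f Z 0 = (\<Sum>A\<in>\<A>. if A = Z then 1 else 0)"
      unfolding f_def using fin sdist_eq_0_iff[OF finZ] by (intro sum.cong) (auto simp: power_0_left)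
    also have "\<dots> \<le> 1" using fin by (simp add: sum.delta')
    finally have "G Z 0 \<le> 1" by (simp add: G_def w_def)
    with le[of Y r] that r \<open>t Z = 0\<close> show ?thesis by (simp add: G_def)
  qed
  have "f (X \<inter> U) r * w r \<le> 1"
  proof (rule field_le_epsilon)
    fix e :: real assume "e > 0"
    have "f (X \<inter> U) r * w r \<le> 1 + e * r" using \<open>e > 0\<close> by (intro bound) auto
    also have "\<dots> \<le> 1 + e" using \<open>e > 0\<close> r by simp
    finally show "f (X \<inter> U) r * w r \<le> 1 + e" .
  qed
  moreover have "w r = inverse ((1 + r) ^ (2 * d))"
    using r exp_of_nat_mult[of "2 * d" "ln (1 + r)"] by (simp add: w_def exp_minus)
  ultimately have "f (X \<inter> U) r \<le> (1 + r) ^ (2 * d)"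
    using r by (simp add: field_simps)
  then show ?thesis using f_Int[OF X, of r] r by (simp add: f_def)
qed

section \<open>A weak Kleitman bound for two families\<close>

text \<open>Induction on the ground set, splitting each family by membership of \<open>i\<close>.
  Two families are needed because the two halves of a single one already differ. Mixed halves spend
  one unit of distance on \<open>i\<close> and so gain a factor \<open>s\<close>.\<close>

lemma cross_diameter_card_bound:
  fixes s :: real
  assumes "finite I" "0 < s" "s \<le> 1" "\<A> \<subseteq> Pow I" "\<B> \<subseteq> Pow I"
    and "\<And>A B. A \<in> \<A> \<Longrightarrow> B \<in> \<B> \<Longrightarrow> sdist A B \<le> D"
  shows "real (card \<A>) * real (card \<B>) * s ^ D \<le> (1 + s) ^ (2 * card I)"
  using assms
proof (induction I arbitrary: \<A> \<B> D rule: finite_induct)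
  case empty
  have "card \<A> \<le> 1" "card \<B> \<le> 1"
    using empty card_mono[of "{{}}" \<A>] card_mono[of "{{}}" \<B>] by auto
  moreover have "s ^ D \<le> 1" using empty by (intro power_le_one) auto
  ultimately have "real (card \<A>) * real (card \<B>) * s ^ D \<le> 1 * 1 * 1"
    using empty by (intro mult_mono) auto
  then show ?case by simp
next
  case (insert i I)
  define off where "off = (\<lambda>\<C>. {C \<in> \<C>. i \<notin> C})"
  define on where "on = (\<lambda>\<C>. (\<lambda>C. C - {i}) ` {C \<in> \<C>. i \<in> C})"
  have split: "card \<C> = card (off \<C>) + card (on \<C>)" if "\<C> \<subseteq> Pow (insert i I)" for \<C>
  proof -
    have "finite \<C>" using that insert.hyps finite_subset by fastforce
    moreover have "card (on \<C>) = card {C \<in> \<C>. i \<in> C}"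
      unfolding on_def by (rule card_image) (auto intro!: inj_onI)
    moreover have "\<C> = off \<C> \<union> {C \<in> \<C>. i \<in> C}" "off \<C> \<inter> {C \<in> \<C>. i \<in> C} = {}"
      by (auto simp: off_def)
    ultimately show ?thesis
      using card_Un_disjoint[of "off \<C>" "{C \<in> \<C>. i \<in> C}"] by (simp add: off_def)
  qed
  have Pow: "off \<C> \<subseteq> Pow I" "on \<C> \<subseteq> Pow I" if "\<C> \<subseteq> Pow (insert i I)" for \<C>
    using that by (auto simp: off_def on_def)
  have fin: "finite C" if "C \<in> \<A> \<union> \<B>" for C
    using that insert.prems insert.hyps(1) by (metis PowD Un_iff finite_insert finite_subset subsetD)
  have offoff: "sdist A B \<le> D" if "A \<in> off \<A>" "B \<in> off \<B>" for A B
    using that insert.prems(5) by (auto simp: off_def)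
  have onon: "sdist A B \<le> D" if "A \<in> on \<A>" "B \<in> on \<B>" for A B
  proof -
    obtain A' B' where AB: "A' \<in> \<A>" "B' \<in> \<B>" "A = A' - {i}" "B = B' - {i}"
      using \<open>A \<in> on \<A>\<close> \<open>B \<in> on \<B>\<close> by (auto simp: on_def)
    then have "sdist A B \<le> sdist A' B'" using fin by (intro sdist_mono) auto
    with insert.prems(5)[OF AB(1,2)] show ?thesis by simp
  qed
  have offon: "Suc (sdist A B) \<le> D" if "A \<in> off \<A>" "B \<in> on \<B>" for A B
  proof -
    obtain B' where AB: "A \<in> \<A>" "i \<notin> A" "B' \<in> \<B>" "i \<in> B'" "B = B' - {i}"
      using \<open>A \<in> off \<A>\<close> \<open>B \<in> on \<B>\<close> by (auto simp: on_def off_def)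
    then have "sym_diff A B' = insert i (sym_diff A B)" by auto
    then have "sdist A B' = Suc (sdist A B)"
      using AB fin by (simp add: sdist_def)
    with insert.prems(5)[OF AB(1,3)] show ?thesis by simp
  qed
  have onoff: "Suc (sdist A B) \<le> D" if "A \<in> on \<A>" "B \<in> off \<B>" for A B
  proof -
    obtain A' where AB: "B \<in> \<B>" "i \<notin> B" "A' \<in> \<A>" "i \<in> A'" "A = A' - {i}"
      using \<open>A \<in> on \<A>\<close> \<open>B \<in> off \<B>\<close> by (auto simp: on_def off_def)
    then have "sym_diff A' B = insert i (sym_diff A B)" by auto
    then have "sdist A' B = Suc (sdist A B)"
      using AB fin by (simp add: sdist_def)
    with insert.prems(5)[OF AB(3,1)] show ?thesis by simp
  qed
  define G where "G = (1 + s) ^ (2 * card I) / s ^ D"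
  have "G > 0" using insert.prems by (simp add: G_def)
  have le: "real (card \<C>) * real (card \<D>) \<le> G"
    if "\<C> \<subseteq> Pow I" "\<D> \<subseteq> Pow I" "\<And>A B. A \<in> \<C> \<Longrightarrow> B \<in> \<D> \<Longrightarrow> sdist A B \<le> D" for \<C> \<D>
    using insert.IH[OF insert.prems(1,2) that] insert.prems by (simp add: G_def field_simps)
  have le': "real (card \<C>) * real (card \<D>) \<le> s * G"
    if C: "\<C> \<subseteq> Pow I" "\<D> \<subseteq> Pow I" "\<And>A B. A \<in> \<C> \<Longrightarrow> B \<in> \<D> \<Longrightarrow> Suc (sdist A B) \<le> D" for \<C> \<D>
  proof (cases "\<C> = {} \<or> \<D> = {}")
    case True
    then show ?thesis using \<open>G > 0\<close> insert.prems by auto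
  next
    case False
    then obtain D' where D': "D = Suc D'" using C(3) by (metis Suc_le_D all_not_in_conv)
    have "real (card \<C>) * real (card \<D>) * s ^ D' \<le> (1 + s) ^ (2 * card I)"
      using C D' by (intro insert.IH insert.prems) auto
    then show ?thesis using insert.prems by (simp add: G_def D' field_simps)
  qed
  define a0 a1 b0 b1 where "a0 = real (card (off \<A>))" and "a1 = real (card (on \<A>))"
    and "b0 = real (card (off \<B>))" and "b1 = real (card (on \<B>))"
  note PA = Pow[OF insert.prems(3)] and PB = Pow[OF insert.prems(4)]
  have b: "a0 * b0 \<le> G" "a1 * b1 \<le> G" "a0 * b1 \<le> s * G" "a1 * b0 \<le> s * G"
    unfolding a0_def a1_def b0_def b1_def
    by (intro le le' PA PB offoff onon offon onoff; assumption)+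
  \<comment> \<open>Adding the four bounds would give only \<open>2 + 2 * s\<close>. The gain comes
    from \<open>(a0 * b0) * (a1 * b1) = (a0 * b1) * (a1 * b0)\<close>: the two diagonal products
    cannot both be near \<open>G\<close>, and their sum is at most
    \<open>(1 + s^2) * G\<close>.\<close>
  have "0 \<le> (G - a0 * b0) * (G - a1 * b1)" using b by simp
  moreover have "(a0 * b1) * (a1 * b0) \<le> (s * G) * (s * G)"
    by (rule mult_mono'[OF b(3,4)]) (auto simp: a0_def a1_def b0_def b1_def)
  ultimately have "G * (a0 * b0 + a1 * b1) \<le> G * (G + s\<^sup>2 * G)"
    by (simp add: algebra_simps power2_eq_square)
  then have "a0 * b0 + a1 * b1 \<le> G + s\<^sup>2 * G" using \<open>G > 0\<close> by simp
  then have "(a0 + a1) * (b0 + b1) \<le> (1 + s)\<^sup>2 * G"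
    using b(3,4) by (simp add: algebra_simps power2_eq_square)
  moreover have "real (card \<A>) = a0 + a1" "real (card \<B>) = b0 + b1"
    using split[OF insert.prems(3)] split[OF insert.prems(4)]
    by (simp_all add: a0_def a1_def b0_def b1_def)
  ultimately have "real (card \<A>) * real (card \<B>) \<le> (1 + s)\<^sup>2 * G" by simp
  then show ?case
    using insert.prems(1) insert.hyps by (simp add: G_def field_simps power_add power2_eq_square)
qed

text \<open>Absorbs a factor \<open>c ^ k\<close>, with \<open>k\<close> a small fraction of
  \<open>n\<close>, into a base slightly above 1; the third premise comes from Bernoulli's
  inequality.\<close>

lemma power_le_of_le_power:
  fixes c x :: real
  assumes "x \<ge> 0" "c \<ge> 1" "c \<le> (1 + x) ^ q" "q * k \<le> n"
  shows "c ^ k \<le> (1 + x) ^ n"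
proof -
  have "c ^ k \<le> ((1 + x) ^ q) ^ k" using assms by (intro power_mono) auto
  also have "\<dots> \<le> (1 + x) ^ n"
    unfolding power_mult[symmetric] using assms by (intro power_increasing) auto
  finally show ?thesis .
qed

section \<open>Counting a family of diameter at most \<open>d\<close> with no centre of radius
  \<open>d - 1\<close>\<close>

text \<open>\<open>ex_far\<close> is what maximality and the absence of a 1-ball contribute.
  Finiteness of the family is not assumed but derived.\<close>

locale diametral_family =
  fixes \<S> :: "'a set set" and d :: nat
  assumes finite_member: "A \<in> \<S> \<Longrightarrow> finite A"
    and sdist_le: "A \<in> \<S> \<Longrightarrow> B \<in> \<S> \<Longrightarrow> sdist A B \<le> d"
    and ex_far: "finite X \<Longrightarrow> \<exists>T\<in>\<S>. d \<le> sdist X T"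
begin

lemma subfamily_weight_sum_le:
  fixes r :: real
  assumes "finite \<A>" "\<A> \<subseteq> \<S>" "0 \<le> r" "r < 1" "finite X"
  shows "(\<Sum>A\<in>\<A>. r ^ sdist X A) \<le> (1 + r) ^ (2 * d)"
  by (rule weight_sum_le[where \<T> = \<S>])
     (use assms finite_member sdist_le ex_far in auto)

lemma card_in_ball_le:
  fixes r :: real
  assumes "finite \<A>" "\<A> \<subseteq> \<S>" "0 \<le> r" "r < 1" "finite X"
    and "\<And>A. A \<in> \<A> \<Longrightarrow> sdist X A \<le> k"
  shows "real (card \<A>) * r ^ k \<le> (1 + r) ^ (2 * d)"
proof -
  have "real (card \<A>) * r ^ k = (\<Sum>A\<in>\<A>. r ^ k)" by simp
  also have "\<dots> \<le> (\<Sum>A\<in>\<A>. r ^ sdist X A)"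
    by (intro sum_mono power_decreasing) (use assms in auto)
  also have "\<dots> \<le> (1 + r) ^ (2 * d)"
    by (intro subfamily_weight_sum_le) (use assms in auto)
  finally show ?thesis .
qed

text \<open>All members lie within \<open>d\<close> of a fixed member, so the ball bound with
  \<open>r = 1/2\<close> limits every finite subfamily by the same \<open>M\<close>.\<close>

lemma finite_family: "finite \<S>"
proof -
  obtain X where X: "X \<in> \<S>" using ex_far[of "{}"] by auto
  define M where "M = (1 + 1/2 :: real) ^ (2 * d) * 2 ^ d"
  have "card \<A> \<le> nat \<lfloor>M\<rfloor>" if "\<A> \<subseteq> \<S>" "finite \<A>" for \<A>
  proof -
    have "real (card \<A>) * (1/2) ^ d \<le> (1 + 1/2) ^ (2 * d)"
      by (rule card_in_ball_le[of _ _ X]) (use that X finite_member sdist_le in auto)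
    then have "real (card \<A>) \<le> M" by (simp add: M_def field_simps)
    then show ?thesis by (simp add: le_nat_floor)
  qed
  then show ?thesis using finite_if_finite_subsets_card_bdd[of \<S> "nat \<lfloor>M\<rfloor>"] by blast
qed

lemma card_le_of_small_mean_dist:
  fixes t Q :: real
  assumes "finite X" "t > 0" "(\<Sum>A\<in>\<S>. real (sdist X A)) = real (card \<S>) * Q"
  shows "real (card \<S>) \<le> exp (t * Q) * (1 + exp (- t)) ^ (2 * d)"
proof -
  \<comment> \<open>Jensen's inequality, through the tangent line of \<open>exp\<close> at the mean.\<close>
  have "exp (- t * Q) * real (card \<S>) =
      (\<Sum>A\<in>\<S>. exp (- t * Q) * (1 + - t * (real (sdist X A) - Q)))"
    using assms(3) by (simp add: sum.distrib sum_subtractf sum_negf flip: sum_distrib_left)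
  also have "\<dots> \<le> (\<Sum>A\<in>\<S>. exp (- t) ^ sdist X A)"
  proof (rule sum_mono)
    fix A
    have "exp (- t * Q) * (1 + - t * (real (sdist X A) - Q))
       \<le> exp (- t * Q) * exp (- t * (real (sdist X A) - Q))"
      by (intro mult_left_mono exp_ge_add_one_self) auto
    also have "\<dots> = exp (real (sdist X A) * - t)"
      by (simp add: algebra_simps flip: exp_add)
    finally show "exp (- t * Q) * (1 + - t * (real (sdist X A) - Q)) \<le> exp (- t) ^ sdist X A"
      by (simp only: exp_of_nat_mult)
  qed
  also have "\<dots> \<le> (1 + exp (- t)) ^ (2 * d)"
    by (rule subfamily_weight_sum_le) (use assms finite_family in auto)
  finally show ?thesis by (simp add: exp_minus field_simps)
qed

text \<open>Half of the family is counted as traces on \<open>I\<close> times members per trace. The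
  traces number at most \<open>3.1 ^ d\<close>; members with one trace differ little from
  \<open>X\<close> on \<open>J\<close> and number at most \<open>1.1 ^ d\<close>. The product
  \<open>3.41 ^ d\<close> leaves room below \<open>4 ^ d\<close>.\<close>

lemma card_le_of_few_coordinates:
  assumes "d \<ge> 1" and IJ: "finite I" "finite J" "I \<inter> J = {}" "\<Union>\<S> \<subseteq> I \<union> J" and X: "finite X"
    and cardI: "250 * card I \<le> 501 * d"
    and outside: "(\<Sum>A\<in>\<S>. real (card (sym_diff X A \<inter> J))) \<le> real (card \<S>) * (real d / 500)"
  shows "real (card \<S>) \<le> 2 * (341 / 100) ^ d"
proof -
  \<comment> \<open>By Markov's inequality at least half of the family is within \<open>d / 250\<close> of \<open>X\<close> on \<open>J\<close>.\<close>
  define \<S>' where "\<S>' = {A \<in> \<S>. 250 * card (sym_diff X A \<inter> J) \<le> d}"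
  define P where "P = (\<lambda>A. A \<inter> I) ` \<S>'"
  define F where "F = (\<lambda>p. {A \<in> \<S>'. A \<inter> I = p})"
  have fin: "finite \<S>'" "\<S>' \<subseteq> \<S>" using finite_family by (auto simp: \<S>'_def)
  have half: "real (card \<S>) \<le> 2 * real (card \<S>')"
  proof -
    have "real (card (\<S> - \<S>')) * (real d / 250) = (\<Sum>A\<in>\<S> - \<S>'. real d / 250)" by simp
    also have "\<dots> \<le> (\<Sum>A\<in>\<S> - \<S>'. real (card (sym_diff X A \<inter> J)))"
      by (rule sum_mono) (auto simp: \<S>'_def)
    also have "\<dots> \<le> (\<Sum>A\<in>\<S>. real (card (sym_diff X A \<inter> J)))"
      by (rule sum_mono2) (use finite_family in auto)
    finally have "real d * (real (card (\<S> - \<S>')) * 2) \<le> real d * real (card \<S>)"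
      using outside by (simp add: field_simps)
    then have "real (card (\<S> - \<S>')) * 2 \<le> real (card \<S>)"
      using \<open>d \<ge> 1\<close> by simp
    moreover have "card \<S> = card \<S>' + card (\<S> - \<S>')"
      using fin finite_family by (simp add: card_Diff_subset card_mono)
    ultimately show ?thesis by linarith
  qed
  have fibre: "real (card (F p)) \<le> (11/10) ^ d" if "p \<in> P" for p
  proof -
    have "p \<subseteq> I" using that by (auto simp: P_def)
    define k where "k = d div 250"
    \<comment> \<open>The fibre lies in a ball of radius \<open>d div 250\<close>. With
      \<open>r = 1/32\<close> both \<open>(1 + r)^2\<close> and the 250th root of
      \<open>1 / r\<close> are close to 1.\<close>
    have "real (card (F p)) * (1/32) ^ k \<le> (1 + 1/32) ^ (2 * d)"
    proof (rule card_in_ball_le)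
      show "finite (p \<union> (X \<inter> J))" using X IJ \<open>p \<subseteq> I\<close> finite_subset by auto
      fix A assume A: "A \<in> F p"
      then have "A \<subseteq> I \<union> J" "A \<inter> I = p" using IJ fin by (auto simp: F_def)
      then have "sym_diff (p \<union> (X \<inter> J)) A = sym_diff X A \<inter> J" using IJ by auto
      then show "sdist (p \<union> (X \<inter> J)) A \<le> k" using A by (auto simp: F_def \<S>'_def sdist_def k_def)
    qed (use fin in \<open>auto simp: F_def\<close>)
    then have "real (card (F p)) \<le> (1 + 1/32) ^ (2 * d) * 32 ^ k" by (simp add: field_simps)
    also have "(32::real) ^ k \<le> (1 + 1/50) ^ d"
    proof (rule power_le_of_le_power)
      have "(2::real) ^ 5 \<le> ((1 + 1/50) ^ 50) ^ 5"
        using Bernoulli_inequality[of "1/50 :: real" 50] by (intro power_mono) auto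
      then show "(32::real) \<le> (1 + 1/50) ^ 250" by (simp flip: power_mult)
    qed (auto simp: k_def)
    also have "(1 + 1/32 :: real) ^ (2 * d) * (1 + 1/50) ^ d = ((1 + 1/32)\<^sup>2 * (1 + 1/50)) ^ d"
      by (simp only: power_mult power_mult_distrib)
    also have "\<dots> \<le> (11/10) ^ d" by (rule power_mono) (auto simp: power2_eq_square)
    finally show ?thesis by simp
  qed
  have "real (card P) \<le> (31/10) ^ d"
  proof -
    \<comment> \<open>Truncated subtraction: \<open>card I \<le> 2 * d + e\<close> in either case,
      and \<open>250 * e \<le> d\<close>.\<close>
    define e where "e = card I - 2 * d"
    \<comment> \<open>\<open>s = 1/3\<close> minimises \<open>(1 + s) ^ 4 / s\<close>; the minimum
      \<open>256/27\<close> has square root about 3.08.\<close>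
    have "real (card P) * real (card P) * (1/3) ^ d \<le> (1 + 1/3) ^ (2 * card I)"
    proof (rule cross_diameter_card_bound)
      fix A B assume "A \<in> P" "B \<in> P"
      then obtain A' B' where AB: "A' \<in> \<S>" "B' \<in> \<S>" "A = A' \<inter> I" "B = B' \<inter> I"
        using fin by (auto simp: P_def)
      then have "sdist A B \<le> sdist A' B'" using finite_member by (intro sdist_mono) auto
      with sdist_le[OF AB(1,2)] show "sdist A B \<le> d" by simp
    qed (use IJ in \<open>auto simp: P_def\<close>)
    also have "(1 + 1/3 :: real) = 4/3" by simp
    also have "(4/3 :: real) ^ (2 * card I) \<le> (4/3) ^ (4 * d + 2 * e)"
      by (rule power_increasing) (auto simp: e_def)
    also have "\<dots> = ((4/3) ^ 4) ^ d * ((4/3) ^ e)\<^sup>2"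
      by (simp only: power_add power_even_eq power_mult[of _ 4])
    also have "\<dots> \<le> ((4/3) ^ 4) ^ d * ((1 + 1/500) ^ d)\<^sup>2"
    proof (intro mult_left_mono power_mono)
      show "(4/3 :: real) ^ e \<le> (1 + 1/500) ^ d"
        by (rule power_le_of_le_power[of _ _ 250])
           (use Bernoulli_inequality[of "1/500 :: real" 250] cardI in \<open>auto simp: e_def\<close>)
    qed auto
    finally have "real (card P) * real (card P) * (1/3) ^ d
        \<le> ((4/3) ^ 4) ^ d * ((1 + 1/500) ^ d)\<^sup>2" .
    then have "(real (card P))\<^sup>2 \<le> 3 ^ d * (((4/3) ^ 4) ^ d * ((1 + 1/500) ^ d)\<^sup>2)"
      by (simp add: field_simps power2_eq_square)
    also have "\<dots> = (3 * (4/3) ^ 4 * (1 + 1/500)\<^sup>2) ^ d"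
      by (simp only: power_mult_distrib mult.assoc power_even_eq[symmetric] power_mult)
    also have "\<dots> \<le> ((31/10)\<^sup>2) ^ d"
      by (rule power_mono) (auto simp: power2_eq_square eval_nat_numeral)
    also have "\<dots> = ((31/10) ^ d)\<^sup>2" by (simp only: power_even_eq[symmetric] power_mult)
    finally show ?thesis by (rule power2_le_imp_le) auto
  qed
  have "finite P" using fin by (simp add: P_def)
  have "\<S>' = (\<Union>p\<in>P. F p)" by (auto simp: P_def F_def)
  then have "card \<S>' \<le> (\<Sum>p\<in>P. card (F p))" using card_UN_le[OF \<open>finite P\<close>] by simp
  then have "real (card \<S>') \<le> (\<Sum>p\<in>P. real (card (F p)))" by (simp flip: of_nat_sum)
  also have "\<dots> \<le> (\<Sum>p\<in>P. (11/10) ^ d)" by (intro sum_mono fibre)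
  also have "\<dots> = real (card P) * (11/10) ^ d" by simp
  also have "\<dots> \<le> (31/10) ^ d * (11/10) ^ d"
    using \<open>real (card P) \<le> (31/10) ^ d\<close> by (intro mult_right_mono) auto
  also have "\<dots> = (341/100) ^ d" by (simp flip: power_mult_distrib)
  finally show ?thesis using half by simp
qed

text \<open>With \<open>m i\<close> the minority share at coordinate \<open>i\<close>, the mean
  distance to the majority set \<open>X\<close> is \<open>Q\<close>, the sum of \<open>m i\<close>,
  and that between two members is the sum of \<open>2 * m i * (1 - m i)\<close>, at most
  \<open>d\<close>. Hence if \<open>Q\<close> is near \<open>d\<close>, the sum of
  \<open>m i * (1 - 2 * m i)\<close> is small and each \<open>m i\<close> is near 0 or 1/2 on
  average.\<close>

lemma card_le:
  assumes d: "d \<ge> 50"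
  shows "real (card \<S>) \<le> (4 - 1 / 10 ^ 10) ^ d"
proof -
  define U where "U = \<Union>\<S>"
  have U: "finite U" "\<And>A. A \<in> \<S> \<Longrightarrow> A \<subseteq> U"
    using finite_family finite_member by (auto simp: U_def)
  define N where "N = real (card \<S>)"
  have "N > 0" using finite_family ex_far[of "{}"] by (auto simp: N_def card_gt_0_iff)
  define p where "p = (\<lambda>i. real (card {A \<in> \<S>. i \<in> A}) / N)"
  define m where "m = (\<lambda>i. min (p i) (1 - p i))"
  define X where "X = {i \<in> U. p i > 1/2}"
  have X: "finite X" using U by (simp add: X_def)
  have m: "0 \<le> m i" "m i \<le> 1/2" for i
  proof -
    have "card {A \<in> \<S>. i \<in> A} \<le> card \<S>" using finite_family by (intro card_mono) auto
    then have "0 \<le> p i" "p i \<le> 1" using \<open>N > 0\<close> by (auto simp: p_def N_def)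
    then show "0 \<le> m i" "m i \<le> 1/2" by (auto simp: m_def min_def)
  qed
  have count: "(\<Sum>A\<in>\<S>. if i \<in> A then x else y) = N * (p i * x + (1 - p i) * y)" for i and x y :: real
  proof -
    have "(\<Sum>A\<in>\<S>. if i \<in> A then x else y) = (\<Sum>A\<in>\<S>. y + (if i \<in> A then x - y else 0))"
      by (rule sum.cong) auto
    also have "\<dots> = N * y + real (card {A \<in> \<S>. i \<in> A}) * (x - y)"
      using finite_family by (simp add: sum.distrib N_def flip: sum.inter_filter)
    also have "\<dots> = N * (p i * x + (1 - p i) * y)"
      using \<open>N > 0\<close> by (simp add: p_def field_simps)
    finally show ?thesis .
  qed
  \<comment> \<open>The case split on \<open>i \<in> B\<close> puts the summand in the form that
    \<open>count\<close> evaluates when summed over \<open>B\<close>.\<close>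
  have card_sum: "real (card (sym_diff A B \<inter> J)) = (\<Sum>i\<in>J. if i \<in> B then of_bool (i \<notin> A) else of_bool (i \<in> A))"
    if "J \<subseteq> U" for A B J
  proof -
    have "finite J" using that U finite_subset by blast
    have "sym_diff A B \<inter> J = {i \<in> J. i \<in> sym_diff A B}" by auto
    then have "real (card (sym_diff A B \<inter> J)) = (\<Sum>i\<in>{i \<in> J. i \<in> sym_diff A B}. 1)"
      by (simp only: sum_constant mult_1_right)
    also have "\<dots> = (\<Sum>i\<in>J. if i \<in> sym_diff A B then 1 else 0)"
      by (rule sum.inter_filter[OF \<open>finite J\<close>])
    also have "\<dots> = (\<Sum>i\<in>J. if i \<in> B then of_bool (i \<notin> A) else of_bool (i \<in> A))"
      by (rule sum.cong) auto
    finally show ?thesis .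
  qed
  have sdist_sum: "real (sdist A B) = real (card (sym_diff A B \<inter> U))" if "A \<subseteq> U" "B \<subseteq> U" for A B
  proof -
    have "sym_diff A B \<inter> U = sym_diff A B" using that by auto
    then show ?thesis by (simp add: sdist_def)
  qed
  have to_X: "(\<Sum>A\<in>\<S>. real (card (sym_diff X A \<inter> J))) = N * (\<Sum>i\<in>J. m i)" if J: "J \<subseteq> U" for J
  proof -
    have "(\<Sum>A\<in>\<S>. real (card (sym_diff X A \<inter> J))) =
        (\<Sum>i\<in>J. \<Sum>A\<in>\<S>. if i \<in> A then of_bool (i \<notin> X) else of_bool (i \<in> X))"
      unfolding card_sum[OF J] by (rule sum.swap)
    also have "\<dots> = (\<Sum>i\<in>J. N * m i)"
      by (rule sum.cong) (use J in \<open>auto simp: count m_def X_def\<close>)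
    finally show ?thesis by (simp add: sum_distrib_left)
  qed
  have "N * N * (\<Sum>i\<in>U. 2 * m i * (1 - m i)) = (\<Sum>A\<in>\<S>. \<Sum>B\<in>\<S>. real (sdist A B))"
  proof -
    have "(\<Sum>A\<in>\<S>. \<Sum>B\<in>\<S>. real (sdist A B)) =
        (\<Sum>A\<in>\<S>. \<Sum>B\<in>\<S>. \<Sum>i\<in>U. if i \<in> B then of_bool (i \<notin> A) else of_bool (i \<in> A))"
      by (intro sum.cong refl) (simp add: U sdist_sum card_sum)
    also have "\<dots> = (\<Sum>A\<in>\<S>. \<Sum>i\<in>U. \<Sum>B\<in>\<S>. if i \<in> B then of_bool (i \<notin> A) else of_bool (i \<in> A))"
      by (intro sum.cong refl sum.swap)
    also have "\<dots> = (\<Sum>i\<in>U. \<Sum>A\<in>\<S>. \<Sum>B\<in>\<S>. if i \<in> B then of_bool (i \<notin> A) else of_bool (i \<in> A))"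
      by (rule sum.swap)
    also have "\<dots> = (\<Sum>i\<in>U. \<Sum>A\<in>\<S>. if i \<in> A then N * (1 - p i) else N * p i)"
      by (intro sum.cong refl) (simp add: count)
    also have "\<dots> = (\<Sum>i\<in>U. N * N * (2 * m i * (1 - m i)))"
      by (intro sum.cong refl) (simp add: count m_def min_def algebra_simps)
    finally show ?thesis by (simp add: sum_distrib_left)
  qed
  also have "\<dots> \<le> (\<Sum>A\<in>\<S>. \<Sum>B\<in>\<S>. real d)"
    by (intro sum_mono) (simp add: sdist_le)
  also have "\<dots> = N * N * real d" by (simp add: N_def)
  finally have pairs: "(\<Sum>i\<in>U. 2 * m i * (1 - m i)) \<le> real d" using \<open>N > 0\<close> by simp
  define Q where "Q = (\<Sum>i\<in>U. m i)"
  have excess: "(\<Sum>i\<in>U. m i * (1 - 2 * m i)) \<le> real d - Q"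
  proof -
    have "(\<Sum>i\<in>U. m i * (1 - 2 * m i)) = (\<Sum>i\<in>U. 2 * m i * (1 - m i)) - Q"
      by (simp add: Q_def algebra_simps flip: sum_subtractf)
    with pairs show ?thesis by simp
  qed
  show ?thesis
  proof (cases "Q \<le> (1 - 1/1000) * real d")
    case True
    \<comment> \<open>With \<open>r = exp (- t)\<close> and \<open>Q \<le> (1 - t) * d\<close>, the
      base is \<open>(exp t + 2 + exp (- t)) * exp (- t^2)\<close>, which is
      \<open>4 - 3 * t^2\<close> to second order.\<close>
    define t :: real where "t = 1/1000"
    have "(\<Sum>A\<in>\<S>. real (sdist X A)) = (\<Sum>A\<in>\<S>. real (card (sym_diff X A \<inter> U)))"
      by (intro sum.cong refl sdist_sum) (use U in \<open>auto simp: X_def\<close>)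
    then have "(\<Sum>A\<in>\<S>. real (sdist X A)) = real (card \<S>) * Q"
      by (simp add: to_X N_def Q_def)
    then have "real (card \<S>) \<le> exp (t * Q) * (1 + exp (- t)) ^ (2 * d)"
      by (intro card_le_of_small_mean_dist[OF X]) (auto simp: t_def)
    also have "\<dots> \<le> exp (real d * (t - t * t)) * (1 + exp (- t)) ^ (2 * d)"
      using True by (intro mult_right_mono) (auto simp: t_def)
    also have "\<dots> = (exp (t - t * t) * (1 + exp (- t))\<^sup>2) ^ d"
      by (simp add: exp_of_nat_mult power_mult power_mult_distrib)
    also have "exp (t - t * t) * (1 + exp (- t))\<^sup>2 = (exp t + 2 + inverse (exp t)) * inverse (exp (t * t))"
      by (simp add: exp_diff exp_minus power2_eq_square field_simps)
    also have "\<dots> ^ d \<le> (4 - 1 / 10 ^ 10) ^ d"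
    proof (rule power_mono)
      have "exp t \<le> 1 + t + t\<^sup>2" by (rule exp_bound) (auto simp: t_def)
      moreover have "inverse (exp t) \<le> inverse (1 + t + t\<^sup>2 / 2)"
        by (intro le_imp_inverse_le exp_lower_Taylor_quadratic) (auto simp: t_def power2_eq_square)
      moreover have "inverse (exp (t * t)) \<le> inverse (1 + t * t)"
        by (intro le_imp_inverse_le exp_ge_add_one_self) (auto simp: t_def)
      ultimately have "(exp t + 2 + inverse (exp t)) * inverse (exp (t * t))
        \<le> (1 + t + t\<^sup>2 + 2 + inverse (1 + t + t\<^sup>2 / 2)) * inverse (1 + t * t)"
        by (intro mult_mono add_mono) (auto simp: t_def power2_eq_square)
      also have "\<dots> \<le> 4 - 1 / 10 ^ 10" by (simp add: t_def power2_eq_square)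
      finally show "(exp t + 2 + inverse (exp t)) * inverse (exp (t * t)) \<le> 4 - 1 / 10 ^ 10" .
    qed auto
    finally show ?thesis .
  next
    case False
    \<comment> \<open>For \<open>m\<close> in \<open>[1/4, 1/2]\<close>,
      \<open>1 \<le> 4 * m * (1 - 2 * m) + 2 * m\<close>, so \<open>I\<close> has at most
      \<open>4 * d / 1000 + 2 * d\<close> elements. For \<open>m\<close> in \<open>[0, 1/4]\<close>,
      \<open>m \<le> 2 * m * (1 - 2 * m)\<close>, so the shares outside \<open>I\<close> sum to at
      most \<open>d / 500\<close>.\<close>
    define I where "I = {i \<in> U. m i \<ge> 1/4}"
    have I: "I \<subseteq> U" "finite I" using U by (auto simp: I_def)
    have excess': "(\<Sum>i\<in>U. m i * (1 - 2 * m i)) \<le> real d / 1000" using excess False by simp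
    have nonneg: "0 \<le> m i * (1 - 2 * m i)" for i using m[of i] by simp
    have "Q \<le> (\<Sum>i\<in>U. 2 * m i * (1 - m i))"
      unfolding Q_def
    proof (rule sum_mono)
      fix i show "m i \<le> 2 * m i * (1 - m i)" using nonneg[of i] by (simp add: algebra_simps)
    qed
    then have "Q \<le> real d" using pairs by simp
    have "real (card I) = (\<Sum>i\<in>I. 1)" by simp
    also have "\<dots> \<le> (\<Sum>i\<in>I. 4 * (m i * (1 - 2 * m i)) + 2 * m i)"
    proof (rule sum_mono)
      fix i assume "i \<in> I"
      then have "0 \<le> (4 * m i - 1) * (1 - 2 * m i)" using m[of i] by (simp add: I_def)
      then show "1 \<le> 4 * (m i * (1 - 2 * m i)) + 2 * m i" by (simp add: algebra_simps)
    qed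
    also have "\<dots> \<le> (\<Sum>i\<in>U. 4 * (m i * (1 - 2 * m i)) + 2 * m i)"
      by (rule sum_mono2[OF U(1) I(1)]) (use nonneg m in \<open>simp add: add_nonneg_nonneg\<close>)
    also have "\<dots> = 4 * (\<Sum>i\<in>U. m i * (1 - 2 * m i)) + 2 * Q"
      by (simp add: sum.distrib Q_def sum_distrib_left)
    finally have cardI: "250 * card I \<le> 501 * d" using excess' \<open>Q \<le> real d\<close> by linarith
    have "(\<Sum>i\<in>U - I. m i) \<le> (\<Sum>i\<in>U - I. 2 * (m i * (1 - 2 * m i)))"
    proof (rule sum_mono)
      fix i assume "i \<in> U - I"
      then have "0 \<le> m i * (1 - 4 * m i)" using m[of i] by (intro mult_nonneg_nonneg) (auto simp: I_def)
      then show "m i \<le> 2 * (m i * (1 - 2 * m i))" by (simp add: algebra_simps)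
    qed
    also have "\<dots> \<le> (\<Sum>i\<in>U. 2 * (m i * (1 - 2 * m i)))"
      by (rule sum_mono2) (use U nonneg in auto)
    also have "\<dots> = 2 * (\<Sum>i\<in>U. m i * (1 - 2 * m i))" by (simp add: sum_distrib_left)
    finally have "(\<Sum>i\<in>U - I. m i) \<le> real d / 500" using excess' by simp
    then have "(\<Sum>A\<in>\<S>. real (card (sym_diff X A \<inter> (U - I)))) \<le> N * (real d / 500)"
      using \<open>N > 0\<close> by (subst to_X) auto
    then have "real (card \<S>) \<le> 2 * (341 / 100) ^ d"
      using d I U X cardI by (intro card_le_of_few_coordinates[of I "U - I" X]) (auto simp: N_def)
    \<comment> \<open>The Markov factor 2 is absorbed here; this is where \<open>d \<ge> 50\<close>
      is needed.\<close>
    also have "(2::real) \<le> (1 + 1/50) ^ d"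
      using power_le_of_le_power[of "1/50" 2 50 1 d] Bernoulli_inequality[of "1/50 :: real" 50] d by simp
    finally have "real (card \<S>) \<le> (1 + 1/50) ^ d * (341 / 100) ^ d" by simp
    also have "\<dots> = ((1 + 1/50) * (341 / 100)) ^ d" by (rule power_mult_distrib[symmetric])
    also have "\<dots> \<le> (4 - 1 / 10 ^ 10) ^ d" by (rule power_mono) auto
    finally show ?thesis .
  qed
qed

end

section \<open>From maximal sets of sequences to set families\<close>

lemma hamming_dist_le_iff:
  "hamming_dist a b \<le> enat k \<longleftrightarrow> finite {i. a i \<noteq> b i} \<and> card {i. a i \<noteq> b i} \<le> k"
  by (simp add: hamming_dist_def)

lemma hamming_dist_commute: "hamming_dist a b = hamming_dist b a"
  by (simp add: hamming_dist_def eq_commute)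

lemma hamming_diam_le_iff:
  "hamming_diam S \<le> enat d \<longleftrightarrow> (\<forall>a\<in>S. \<forall>b\<in>S. hamming_dist a b \<le> enat d)"
  by (auto simp: hamming_diam_def SUP_le_iff)

lemma hamming_diam_mono: "S \<subseteq> T \<Longrightarrow> hamming_diam S \<le> hamming_diam T"
  unfolding hamming_diam_def by (intro SUP_subset_mono) auto

lemma diam_maximal_memI:
  assumes S: "diam_maximal d S" and y: "y \<in> binary_seqs"
    and near: "\<And>s. s \<in> S \<Longrightarrow> hamming_dist y s \<le> enat d"
  shows "y \<in> S"
proof -
  have diam: "hamming_diam S = enat d" using S by (simp add: diam_maximal_def)
  have "hamming_dist y y \<le> enat d" by (simp add: hamming_dist_le_iff)
  moreover have "\<forall>a\<in>S. \<forall>b\<in>S. hamming_dist a b \<le> enat d"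
    using diam by (simp flip: hamming_diam_le_iff)
  moreover have "\<forall>s\<in>S. hamming_dist s y \<le> enat d"
    using near hamming_dist_commute by metis
  ultimately have "hamming_diam (insert y S) \<le> enat d"
    using near by (simp add: hamming_diam_le_iff)
  moreover have "enat d \<le> hamming_diam (insert y S)"
    using hamming_diam_mono[of S "insert y S"] diam by auto
  ultimately have "insert y S = S"
    using S y unfolding diam_maximal_def by (metis antisym insert_subset subset_insertI)
  then show ?thesis by blast
qed

text \<open>By the triangle inequality every point of the ball is within \<open>d\<close> of all of
  \<open>S\<close>, and maximality then puts it into \<open>S\<close>.\<close>

lemma ball_subset_diam_maximal:
  assumes S: "diam_maximal d S" and "d \<ge> 1"
    and near: "\<And>s. s \<in> S \<Longrightarrow> hamming_dist x s \<le> enat (d - 1)"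
  shows "hamming_ball x 1 \<subseteq> S"
proof
  fix y assume "y \<in> hamming_ball x 1"
  then have y: "y \<in> binary_seqs" "finite {i. x i \<noteq> y i}" "card {i. x i \<noteq> y i} \<le> 1"
    by (auto simp: hamming_ball_def hamming_dist_le_iff)
  show "y \<in> S"
  proof (rule diam_maximal_memI[OF S y(1)])
    fix s assume "s \<in> S"
    then have s: "finite {i. x i \<noteq> s i}" "card {i. x i \<noteq> s i} \<le> d - 1"
      using near by (auto simp: hamming_dist_le_iff)
    have sub: "{i. y i \<noteq> s i} \<subseteq> {i. x i \<noteq> y i} \<union> {i. x i \<noteq> s i}" by auto
    have "card {i. y i \<noteq> s i} \<le> card {i. x i \<noteq> y i} + card {i. x i \<noteq> s i}"
      using card_mono[OF _ sub] card_Un_le[of "{i. x i \<noteq> y i}" "{i. x i \<noteq> s i}"] y s by simp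
    then show "hamming_dist y s \<le> enat d"
      using y s \<open>d \<ge> 1\<close> finite_subset[OF sub] by (simp add: hamming_dist_le_iff)
  qed
qed

text \<open>Recording where a sequence differs from a member \<open>c\<close> makes every code
  finite. With only two letters, \<open>a\<close> and \<open>b\<close> differ at \<open>i\<close>
  exactly when one of them differs from \<open>c\<close> there, so distances are preserved.\<close>

lemma diam_maximal_diametral_family:
  assumes S: "diam_maximal d S" and "d \<ge> 1" and no_ball: "\<not> contains_one_ball S" and c: "c \<in> S"
  shows "diametral_family ((\<lambda>a. {i. a i \<noteq> c i}) ` S) d" "inj_on (\<lambda>a. {i. a i \<noteq> c i}) S"
proof -
  define enc where "enc = (\<lambda>a. {i. a i \<noteq> c i})"
  have bin: "a i = 1 \<or> a i = 2" if "a \<in> binary_seqs" for a i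
    using that by (auto simp: binary_seqs_def Pi_iff)
  have SB: "S \<subseteq> binary_seqs" and diam: "hamming_diam S = enat d"
    using S by (auto simp: diam_maximal_def)
  have dist: "finite {i. a i \<noteq> b i}" "card {i. a i \<noteq> b i} \<le> d" if "a \<in> S" "b \<in> S" for a b
    using that diam hamming_diam_le_iff[of S d] by (auto simp: hamming_dist_le_iff)
  have enc: "sym_diff (enc a) (enc b) = {i. a i \<noteq> b i}"
    if "a \<in> binary_seqs" "b \<in> binary_seqs" for a b
  proof (rule set_eqI)
    fix i
    have "c \<in> binary_seqs" using SB c by blast
    with bin[OF that(1), of i] bin[OF that(2), of i] bin[of c i]
    show "i \<in> sym_diff (enc a) (enc b) \<longleftrightarrow> i \<in> {i. a i \<noteq> b i}" by (auto simp: enc_def)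
  qed
  have "diametral_family (enc ` S) d"
  proof
    show "finite A" if "A \<in> enc ` S" for A
      using that c dist by (auto simp: enc_def)
    show "sdist A B \<le> d" if "A \<in> enc ` S" "B \<in> enc ` S" for A B
    proof -
      obtain a b where ab: "a \<in> S" "b \<in> S" "A = enc a" "B = enc b" using \<open>A \<in> enc ` S\<close> \<open>B \<in> enc ` S\<close> by blast
      with SB have "sym_diff A B = {i. a i \<noteq> b i}" using enc by blast
      with dist[OF ab(1,2)] show ?thesis by (simp add: sdist_def)
    qed
    fix X :: "nat set" assume X: "finite X"
    \<comment> \<open>\<open>3 - c i\<close> swaps the letters 1 and 2, so \<open>x\<close> is the
      sequence with code \<open>X\<close>.\<close>
    define x where "x = (\<lambda>i. if i \<in> X then 3 - c i else c i)"
    have c12: "c i = 1 \<or> c i = 2" for i using bin SB c by blast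
    have "x i \<in> {1, 2}" for i using c12[of i] by (auto simp: x_def)
    moreover have "i \<in> enc x \<longleftrightarrow> i \<in> X" for i using c12[of i] by (auto simp: x_def enc_def)
    ultimately have x: "x \<in> binary_seqs" "enc x = X" by (auto simp: binary_seqs_def)
    show "\<exists>T\<in>enc ` S. d \<le> sdist X T"
    proof (rule ccontr)
      assume "\<not> ?thesis"
      then have less: "sdist X (enc s) < d" if "s \<in> S" for s using that by auto
      have "hamming_dist x s \<le> enat (d - 1)" if "s \<in> S" for s
      proof -
        have eq: "{i. x i \<noteq> s i} = sym_diff X (enc s)"
          using enc[of x s] x SB that by auto
        moreover have "finite (enc s)" using dist[OF that c] by (simp add: enc_def)
        ultimately show ?thesis
          using less[OF that] X unfolding hamming_dist_le_iff eq by (simp add: sdist_def)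
      qed
      then have "hamming_ball x 1 \<subseteq> S" by (rule ball_subset_diam_maximal[OF S \<open>d \<ge> 1\<close>])
      with x no_ball show False by (auto simp: contains_one_ball_def)
    qed
  qed
  moreover have "inj_on enc S"
  proof (rule inj_onI)
    fix a b assume "a \<in> S" "b \<in> S" "enc a = enc b"
    with enc[of a b] SB have "{i. a i \<noteq> b i} = {}" by auto
    then show "a = b" by auto
  qed
  ultimately show "diametral_family ((\<lambda>a. {i. a i \<noteq> c i}) ` S) d" "inj_on (\<lambda>a. {i. a i \<noteq> c i}) S"
    by (simp_all add: enc_def)
qed

theorem theorem3:
  shows "\<exists>d0::nat. \<forall>d\<ge>d0. \<forall>S. S \<subseteq> binary_seqs \<and> diam_maximal d S \<and> \<not> contains_one_ball S \<longrightarrow>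
           finite S \<and> real (card S) \<le> (4 - 1 / 10 ^ 10) ^ d"
proof (intro exI[of _ 50] allI impI, elim conjE)
  fix d S
  assume d: "d \<ge> 50" and S: "diam_maximal d S" "\<not> contains_one_ball S"
  \<comment> \<open>The empty set has diameter 0, the bottom of \<open>enat\<close>.\<close>
  have "S \<noteq> {}"
    using S(1) d by (auto simp: diam_maximal_def hamming_diam_def bot_enat_def zero_enat_def)
  then obtain c where "c \<in> S" by blast
  define enc where "enc = (\<lambda>a :: nat \<Rightarrow> nat. {i. a i \<noteq> c i})"
  have fam: "diametral_family (enc ` S) d" and inj: "inj_on enc S"
    using diam_maximal_diametral_family[OF S(1) _ S(2) \<open>c \<in> S\<close>] d by (simp_all add: enc_def)
  have "finite S"
    using diametral_family.finite_family[OF fam] inj by (rule finite_imageD)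
  moreover have "real (card S) \<le> (4 - 1 / 10 ^ 10) ^ d"
    using diametral_family.card_le[OF fam d] inj by (simp add: card_image)
  ultimately show "finite S \<and> real (card S) \<le> (4 - 1 / 10 ^ 10) ^ d" ..
qed

end
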